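(* Let $\mathcal{F},\mathcal{G}:\mathbb{R}^m\to\mathbb{R}^m$ be sufficiently smooth, and let $\mathbf{u}:[0,T]\to\mathbb{R}^m$ be a sufficiently smooth exact solution of $\frac{d\mathbf{u}}{dt}=\mathcal{F}(\mathbf{u})+\mathcal{G}(\mathbf{u})$. Let $\dot{\mathcal{F}}$ and $\dot{\mathcal{G}}$ be the temporal derivatives evaluated along the full vector field, i.e. $\dot{\mathcal{F}}(\mathbf{v})=\mathcal{F}_{\mathbf u}(\mathbf{v})[\mathcal{F}(\mathbf{v})+\mathcal{G}(\mathbf{v})]$ and $\dot{\mathcal{G}}(\mathbf{v})=\mathcal{G}_{\mathbf u}(\mathbf{v})[\mathcal{F}(\mathbf{v})+\mathcal{G}(\mathbf{v})]$. Then the two-stage method $$\mathbf{u}^*=\mathbf{u}^n+\frac{\Delta t}{2}\mathcal{F}(\mathbf{u}^n)+\frac{\Delta t^2}{8}\dot{\mathcal{F}}(\mathbf{u}^n)+\frac{\Delta t}{2}\mathcal{G}(\mathbf{u}^* )-\frac{\Delta t^2}{8}\dot{\mathcal{G}}(\mathbf{u}^* ),$$ $$\mathbf{u}^{n+1}=\mathbf{u}^n+\Delta t\,\mathcal{F}(\mathbf{u}^n)+\frac{\Delta t^2}{6}\left[\dot{\mathcal{F}}(\mathbf{u}^n)+2\dot{\mathcal{F}}(\mathbf{u}^* )\right]+\Delta t\,\mathcal{G}(\mathbf{u}^{n+1})-\frac{\Delta t^2}{6}\left[\dot{\mathcal{G}}(\mathbf{u}^{n+1})+2\dot{\mathcal{G}}(\mathbf{u}^*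 )\right]$$ is fourth-order accurate in time: if $\mathbf{u}^0=\mathbf{u}(0)$ and $\Delta t=T/N$ with $N\in\mathbb{N}$, then $\|\mathbf{u}^N-\mathbf{u}(T)\|=\mathcal{O}(\Delta t^4)$ as $\Delta t\to 0$.
   Context: $\mathcal{F}_{\mathbf u}$ and $\mathcal{G}_{\mathbf u}$ denote the Jacobian matrices of $\mathcal{F}$ and $\mathcal{G}$. "Sufficiently smooth" means having as many continuous derivatives as needed (e.g. $C^\infty$ suffices). In each step, $\mathbf{u}^*$ and $\mathbf{u}^{n+1}$ are defined implicitly, for sufficiently small $\Delta t$, as the solutions of the two equations that lie near $\mathbf{u}^n$ (i.e. the solution branches that tend to $\mathbf{u}^n$ as $\Delta t\to0$). The implied constant in $\mathcal{O}(\Delta t^4)$ may depend on $\mathcal{F},\mathcal{G},T$ and the exact solution but not on $\Delta t$. *)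

theory Defs
  imports "HOL-Analysis.Analysis" "HOL-Library.Landau_Symbols"
begin

text \<open>
  \<open>Ck_on k S f\<close>: \<open>f\<close> has \<open>k\<close> continuous derivatives on \<open>S\<close>. Higher derivatives are encoded as
  iterated directional derivatives, which in finite dimension is the usual notion of class
  \<open>C\<^sup>k\<close>. Derivatives are taken within \<open>S\<close>, hence one-sided at the endpoints of an interval;
  the notion is meant for sets on which such derivatives are unique (here: the whole space and
  compact intervals of positive length).
\<close>

primrec Ck_on ::
  "nat \<Rightarrow> 'a::euclidean_space set \<Rightarrow> ('a \<Rightarrow> 'b::euclidean_space) \<Rightarrow> bool" where
  "Ck_on 0 S f \<longleftrightarrow> continuous_on S f"
| "Ck_on (Suc k) S f \<longleftrightarrow>
     f differentiable_on S \<and> (\<forall>d. Ck_on k S (\<lambda>x. frechet_derivative f (at x within S) d))"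

definition time_deriv ::
  "(real^'m \<Rightarrow> real^'m) \<Rightarrow> (real^'m \<Rightarrow> real^'m) \<Rightarrow> (real^'m \<Rightarrow> real^'m) \<Rightarrow> real^'m \<Rightarrow> real^'m" where
  "time_deriv F G H v = jacobian H (at v) *v (F v + G v)"

definition stage_eq ::
  "(real^'m \<Rightarrow> real^'m) \<Rightarrow> (real^'m \<Rightarrow> real^'m) \<Rightarrow> real \<Rightarrow> real^'m \<Rightarrow> real^'m \<Rightarrow> bool" where
  "stage_eq F G h v s \<longleftrightarrow>
     s = v + (h / 2) *\<^sub>R F v + (h\<^sup>2 / 8) *\<^sub>R time_deriv F G F v
           + (h / 2) *\<^sub>R G s - (h\<^sup>2 / 8) *\<^sub>R time_deriv F G G s"

definition update_eq ::
  "(real^'m \<Rightarrow> real^'m) \<Rightarrow> (real^'m \<Rightarrow> real^'m) \<Rightarrow> real \<Rightarrow> real^'m \<Rightarrow> real^'m \<Rightarrow> real^'m \<Rightarrow> bool" where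
  "update_eq F G h v s w \<longleftrightarrow>
     w = v + h *\<^sub>R F v
           + (h\<^sup>2 / 6) *\<^sub>R (time_deriv F G F v + 2 *\<^sub>R time_deriv F G F s)
           + h *\<^sub>R G w
           - (h\<^sup>2 / 6) *\<^sub>R (time_deriv F G G w + 2 *\<^sub>R time_deriv F G G s)"

text \<open>
  The implicit equations may have several solutions. The scheme takes the solution branch that
  tends to \<open>v\<close> as the step size tends to 0: \<open>s\<close> and \<open>w\<close> are the values at \<open>h\<close> of
  continuous curves of solutions that start in \<open>v\<close> at step size 0, with \<open>v\<close> held fixed.
\<close>

definition step ::
  "(real^'m \<Rightarrow> real^'m) \<Rightarrow> (real^'m \<Rightarrow> real^'m) \<Rightarrow> real \<Rightarrow> real^'m \<Rightarrow> real^'m \<Rightarrow> real^'m \<Rightarrow> bool" where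
  "step F G h v s w \<longleftrightarrow>
     (\<exists>\<sigma> \<omega>. continuous_on {0..h} \<sigma> \<and> continuous_on {0..h} \<omega> \<and>
            \<sigma> 0 = v \<and> \<omega> 0 = v \<and>
            (\<forall>k\<in>{0<..h}. stage_eq F G k v (\<sigma> k) \<and> update_eq F G k v (\<sigma> k) (\<omega> k)) \<and>
            s = \<sigma> h \<and> w = \<omega> h)"

text \<open>\<open>U n\<close> are the approximations and \<open>S n\<close> the intermediate stages of \<open>N\<close> steps.\<close>

definition scheme ::
  "(real^'m \<Rightarrow> real^'m) \<Rightarrow> (real^'m \<Rightarrow> real^'m) \<Rightarrow> real \<Rightarrow> nat \<Rightarrow> real^'m
    \<Rightarrow> (nat \<Rightarrow> real^'m) \<Rightarrow> (nat \<Rightarrow> real^'m) \<Rightarrow> bool" where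
  "scheme F G h N u0 U S \<longleftrightarrow> U 0 = u0 \<and> (\<forall>n<N. step F G h (U n) (S n) (U (Suc n)))"

end

theory Submission imports Defs begin

text \<open>
  Along the exact solution, the explicit and the implicit half of the update are Hermite-type
  quadrature rules that are exact for integrands of degree at most 3, so inserting the exact
  solution and its midpoint value leaves a defect of order \<open>h ^ 5\<close>. The stage equation has a
  defect of order \<open>h ^ 3\<close> only, but the stage enters the update with a factor \<open>h\<^sup>2\<close>. On a ball
  containing a neighbourhood of the trajectory \<open>F\<close>, \<open>G\<close> and their time derivatives are Lipschitz,
  so for small \<open>h\<close> both implicit equations are contractions, and one step amplifies errors by at
  most a factor \<open>1 + 4 * L * h\<close>. Discrete Gronwall gives the global order 4; the error bound in
  turn keeps the iterates in the ball, where the next step exists and is unique.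
\<close>

section \<open>Smooth curves and their Taylor expansion\<close>

text \<open>The derivative is quantified existentially, so closure properties only have to exhibit
  one. Derivatives within \<open>S\<close> are one-sided at the endpoints of an interval.\<close>

primrec smooth_curve :: "nat \<Rightarrow> real set \<Rightarrow> (real \<Rightarrow> 'a::real_normed_vector) \<Rightarrow> bool" where
  "smooth_curve 0 S g \<longleftrightarrow> continuous_on S g"
| "smooth_curve (Suc k) S g \<longleftrightarrow>
     (\<exists>g'. (\<forall>t\<in>S. (g has_vector_derivative g' t) (at t within S)) \<and> smooth_curve k S g')"

lemma continuous_on_vector_derivative:
  assumes "\<And>t. t \<in> S \<Longrightarrow> (g has_vector_derivative g' t) (at t within S)"
  shows "continuous_on S g"
  using assms by (meson continuous_on_eq_continuous_within has_vector_derivative_continuous)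

lemma smooth_curve_SucD: "smooth_curve (Suc k) S g \<Longrightarrow> smooth_curve k S g"
proof (induction k arbitrary: g)
  case 0
  then show ?case using continuous_on_vector_derivative by auto
next
  case (Suc k)
  from Suc.prems obtain g' where "\<forall>t\<in>S. (g has_vector_derivative g' t) (at t within S)"
    "smooth_curve (Suc k) S g'" by (subst (asm) smooth_curve.simps(2)) blast
  with Suc.IH show ?case by (subst smooth_curve.simps(2)) blast
qed

lemma smooth_curve_const: "smooth_curve k S (\<lambda>t. c)"
proof (induction k arbitrary: c)
  case (Suc k)
  then show ?case by (auto intro!: exI[of _ "\<lambda>t. 0"])
qed simp

lemma smooth_curve_add:
  "smooth_curve k S f \<Longrightarrow> smooth_curve k S g \<Longrightarrow> smooth_curve k S (\<lambda>t. f t + g t)"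
proof (induction k arbitrary: f g)
  case 0
  then show ?case by (simp add: continuous_on_add)
next
  case (Suc k)
  then obtain f' g' where
    "\<forall>t\<in>S. (f has_vector_derivative f' t) (at t within S)" "smooth_curve k S f'"
    "\<forall>t\<in>S. (g has_vector_derivative g' t) (at t within S)" "smooth_curve k S g'"
    by auto
  with Suc.IH show ?case
    by (auto intro!: exI[of _ "\<lambda>t. f' t + g' t"] has_vector_derivative_add)
qed

lemma smooth_curve_sum:
  "finite B \<Longrightarrow> (\<And>b. b \<in> B \<Longrightarrow> smooth_curve k S (f b)) \<Longrightarrow> smooth_curve k S (\<lambda>t. \<Sum>b\<in>B. f b t)"
  by (induction B rule: finite_induct) (auto simp: smooth_curve_const intro: smooth_curve_add)

lemma smooth_curve_scaleR:
  "smooth_curve k S a \<Longrightarrow> smooth_curve k S g \<Longrightarrow> smooth_curve k S (\<lambda>t. a t *\<^sub>R g t)"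
proof (induction k arbitrary: a g)
  case 0
  then show ?case by (simp add: continuous_on_scaleR)
next
  case (Suc k)
  then obtain a' g' where d:
    "\<forall>t\<in>S. (a has_vector_derivative a' t) (at t within S)" "smooth_curve k S a'"
    "\<forall>t\<in>S. (g has_vector_derivative g' t) (at t within S)" "smooth_curve k S g'"
    by auto
  have "\<forall>t\<in>S. ((\<lambda>t. a t *\<^sub>R g t) has_vector_derivative (a t *\<^sub>R g' t + a' t *\<^sub>R g t)) (at t within S)"
    using d by (auto intro!: has_vector_derivative_scaleR simp: has_real_derivative_iff_has_vector_derivative)
  \<comment> \<open>The product rule leaves \<open>a\<close> and \<open>g\<close> undifferentiated;
    both are lowered to order \<open>k\<close> so that the induction hypothesis applies.\<close>
  moreover have "smooth_curve k S (\<lambda>t. a t *\<^sub>R g' t + a' t *\<^sub>R g t)"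
    using d Suc.prems[THEN smooth_curve_SucD] by (intro smooth_curve_add Suc.IH)
  ultimately show ?case by auto
qed

lemma smooth_curve_inner: 
  "smooth_curve k S g \<Longrightarrow> smooth_curve k S (\<lambda>t. g t \<bullet> b)"
proof (induction k arbitrary: g)
  case 0
  then show ?case by (simp add: continuous_on_inner continuous_on_const)
next
  case (Suc k)
  then obtain g' where d:
    "\<forall>t\<in>S. (g has_vector_derivative g' t) (at t within S)" "smooth_curve k S g'"
    by auto
  have "\<forall>t\<in>S. ((\<lambda>t. g t \<bullet> b) has_vector_derivative (g' t \<bullet> b)) (at t within S)"
    using d bounded_linear.has_vector_derivative[OF bounded_linear_inner_left] by blast
  with d Suc.IH show ?case by auto
qed

text \<open>Turns a derivative applied to a moving direction into a combination of derivatives along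
  fixed basis vectors, which are what \<open>Ck_on\<close> controls.\<close>

lemma linear_expansion:
  fixes f :: "'a::euclidean_space \<Rightarrow> 'b::real_vector"
  assumes "linear f"
  shows "f x = (\<Sum>b\<in>Basis. (x \<bullet> b) *\<^sub>R f b)"
  using linear_sum[OF assms, of "\<lambda>b. (x \<bullet> b) *\<^sub>R b" Basis]
  by (simp add: euclidean_representation linear_scale[OF assms])

lemma Ck_on_UNIV_derivative:
  assumes "Ck_on (Suc k) UNIV f"
  shows "(f has_derivative frechet_derivative f (at x)) (at x within S)"
  using assms by (auto simp: differentiable_on_def frechet_derivative_works[symmetric]
      intro: has_derivative_at_withinI)

text \<open>By the chain rule the derivative is \<open>?D (g t) (g' t)\<close>. Expanded over the
  basis it is a sum of coordinates of \<open>g'\<close> times directional derivatives of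
  \<open>f\<close> along the same curve \<open>g\<close>; these are of class \<open>k\<close>, so
  the induction runs over \<open>f\<close>.\<close>

lemma smooth_curve_compose:
  fixes f :: "'a::euclidean_space \<Rightarrow> 'b::euclidean_space"
  shows "Ck_on k UNIV f \<Longrightarrow> smooth_curve k S g \<Longrightarrow> smooth_curve k S (\<lambda>t. f (g t))"
proof (induction k arbitrary: f)
  case 0
  then show ?case using continuous_on_compose2[of UNIV f S g] by auto
next
  case (Suc k)
  then obtain g' where g':
    "\<forall>t\<in>S. (g has_vector_derivative g' t) (at t within S)" "smooth_curve k S g'"
    by auto
  let ?D = "\<lambda>x. frechet_derivative f (at x)"
  have f': "(f has_derivative ?D x) (at x within X)" for x X
    using Ck_on_UNIV_derivative[OF Suc.prems(1)] .
  have "((\<lambda>t. f (g t)) has_vector_derivative ?D (g t) (g' t)) (at t within S)" if "t \<in> S" for t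
    using vector_derivative_diff_chain_within[OF _ f', of g "g' t" t S] g' that by (simp add: o_def)
  moreover have "?D (g t) (g' t) = (\<Sum>b\<in>Basis. (g' t \<bullet> b) *\<^sub>R ?D (g t) b)" for t
    by (rule linear_expansion[OF has_derivative_linear[OF f']])
  moreover have "smooth_curve k S (\<lambda>t. \<Sum>b\<in>Basis. (g' t \<bullet> b) *\<^sub>R ?D (g t) b)"
    using Suc.prems(1) smooth_curve_SucD[OF Suc.prems(2)] g'(2)
    by (intro smooth_curve_sum smooth_curve_scaleR smooth_curve_inner Suc.IH) auto
  ultimately show ?case by (auto intro!: exI[of _ "\<lambda>t. ?D (g t) (g' t)"])
qed

text \<open>Collects the successively chosen derivatives into one indexed family, the form in which
  Taylor expansion uses them.\<close>

lemma smooth_curve_derivatives: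
  assumes "smooth_curve n S g"
  obtains D where "D 0 = g"
    "\<And>i t. i < n \<Longrightarrow> t \<in> S \<Longrightarrow> (D i has_vector_derivative D (Suc i) t) (at t within S)"
    "\<And>i. i \<le> n \<Longrightarrow> continuous_on S (D i)"
proof -
  have "\<exists>D. D 0 = g
    \<and> (\<forall>i<n. \<forall>t\<in>S. (D i has_vector_derivative D (Suc i) t) (at t within S))
    \<and> (\<forall>i\<le>n. continuous_on S (D i))"
    using assms
  proof (induction n arbitrary: g)
    case 0
    then show ?case by auto
  next
    case (Suc n)
    then obtain g' where g':
      "\<forall>t\<in>S. (g has_vector_derivative g' t) (at t within S)" "smooth_curve n S g'"
      by auto
    from Suc.IH[OF g'(2)] obtain D where D: "D 0 = g'"
      "\<forall>i<n. \<forall>t\<in>S. (D i has_vector_derivative D (Suc i) t) (at t within S)"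
      "\<forall>i\<le>n. continuous_on S (D i)" by auto
    have "continuous_on S g" using g'(1) continuous_on_vector_derivative by blast
    with D g' show ?case
      by (intro exI[of _ "case_nat g D"]) (auto simp: less_Suc_eq_0_disj le_Suc_eq split: nat.splits)
  qed
  then show thesis using that by blast
qed

lemma compact_common_bound:
  fixes f :: "'i \<Rightarrow> 'a::topological_space \<Rightarrow> 'b::real_normed_vector"
  assumes "compact S" "finite I" "\<And>i. i \<in> I \<Longrightarrow> continuous_on S (f i)"
  obtains M :: real where "\<And>i t. i \<in> I \<Longrightarrow> t \<in> S \<Longrightarrow> norm (f i t) \<le> M"
proof -
  have "bounded (\<Union>i\<in>I. f i ` S)"
    using assms by (auto intro!: bounded_UN compact_imp_bounded compact_continuous_image)
  then obtain M where "\<forall>x\<in>(\<Union>i\<in>I. f i ` S). norm x \<le> M" by (auto simp: bounded_iff)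
  then show thesis by (intro that[of M]) auto
qed

text \<open>For vector-valued curves the mean value inequality replaces the Lagrange remainder. By
  induction the remainder of the derivative curve is at most \<open>M * s ^ n\<close>, and
  integrating over a length \<open>s\<close> adds one power. The factor \<open>1 / fact n\<close> is
  given away.\<close>

lemma curve_taylor:
  fixes D :: "nat \<Rightarrow> real \<Rightarrow> 'a::real_normed_vector"
  assumes "\<And>i t. i < n \<Longrightarrow> t \<in> {0..T} \<Longrightarrow> (D i has_vector_derivative D (Suc i) t) (at t within {0..T})"
    and "\<And>t. t \<in> {0..T} \<Longrightarrow> norm (D n t) \<le> M"
    and "0 \<le> t" "0 \<le> s" "t + s \<le> T"
  shows "norm (D 0 (t + s) - (\<Sum>i<n. (s ^ i / fact i) *\<^sub>R D i t)) \<le> M * s ^ n"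
  using assms
proof (induction n arbitrary: D s)
  case 0
  then show ?case by auto
next
  case (Suc n)
  \<comment> \<open>The term of index 0 is split off so that termwise differentiation of
    \<open>R\<close> yields \<open>R'\<close>, the remainder of order \<open>n\<close> of the
    shifted family \<open>\<lambda>i. D (Suc i)\<close>.\<close>
  define R where "R x = D 0 (t + x) - (D 0 t + (\<Sum>i<n. (x ^ Suc i / fact (Suc i)) *\<^sub>R D (Suc i) t))" for x
  define R' where "R' x = D 1 (t + x) - (\<Sum>i<n. (x ^ i / fact i) *\<^sub>R D (Suc i) t)" for x
  have M: "0 \<le> M" using Suc.prems(2)[of t] Suc.prems by (smt (verit) atLeastAtMost_iff norm_ge_zero)
  have "((\<lambda>x. D 0 (t + x)) has_vector_derivative D 1 (t + x)) (at x within {0..s})" if "x \<in> {0..s}" for x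
  proof -
    have "((\<lambda>x. t + x) has_vector_derivative 1) (at x within {0..s})"
      by (auto intro!: derivative_eq_intros)
    moreover have "(D 0 has_vector_derivative D 1 (t + x)) (at (t + x) within (\<lambda>x. t + x) ` {0..s})"
      using Suc.prems(1)[of 0 "t + x"] Suc.prems(3-5) that
      by (auto intro!: has_vector_derivative_within_subset[where S = "{0..T}"])
    ultimately show ?thesis
      using vector_diff_chain_within[of "\<lambda>x. t + x" 1 x "{0..s}" "D 0"] by (simp add: o_def)
  qed
  note d0 = this
  have pw: "((\<lambda>x. x ^ Suc i / fact (Suc i)) has_vector_derivative (x ^ i / fact i)) (at x within {0..s})"
    for i and x :: real
    unfolding has_real_derivative_iff_has_vector_derivative[symmetric]
    using DERIV_cdivide[OF DERIV_pow[of "Suc i" x "{0..s}"], of "fact (Suc i)"] by (simp del: power_Suc of_nat_Suc)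
  have ds: "((\<lambda>x. \<Sum>i<n. (x ^ Suc i / fact (Suc i)) *\<^sub>R D (Suc i) t) has_vector_derivative
      (\<Sum>i<n. (x ^ i / fact i) *\<^sub>R D (Suc i) t)) (at x within {0..s})" for x
    by (intro has_vector_derivative_sum bounded_linear.has_vector_derivative[OF bounded_linear_scaleR_left] pw)
  have "(R has_vector_derivative R' x) (at x within {0..s})" if "x \<in> {0..s}" for x
    using has_vector_derivative_diff[OF d0[OF that] has_vector_derivative_add[OF has_vector_derivative_const ds]]
    unfolding R_def R'_def by simp
  moreover have "norm (R' x) \<le> M * s ^ n" if "x \<in> {0..s}" for x
  proof -
    have "norm (R' x) \<le> M * x ^ n"
      using Suc.IH[of "\<lambda>i. D (Suc i)" x] Suc.prems that by (auto simp: R'_def)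
    also have "\<dots> \<le> M * s ^ n" using that M by (auto intro!: mult_left_mono power_mono)
    finally show ?thesis .
  qed
  \<comment> \<open>Since \<open>R 0 = 0\<close>, the mean value inequality on \<open>{0..s}\<close>
    bounds the remainder itself.\<close>
  ultimately have "norm (R s - R 0) \<le> M * s ^ n * norm (s - 0)"
    using Suc.prems M
    by (intro differentiable_bound[where S = "{0..s}" and f' = "\<lambda>x h. h *\<^sub>R R' x"] onorm_bound)
       (auto simp: has_vector_derivative_def mult.commute[of _ "\<bar>_\<bar>"] intro!: mult_left_mono)
  then show ?case
    using Suc.prems by (simp add: R_def sum.lessThan_Suc_shift mult_ac del: sum.lessThan_Suc)
qed

section \<open>Defects of the exact solution\<close>

lemma norm_diff_mono: "norm a \<le> r \<Longrightarrow> norm b \<le> s \<Longrightarrow> norm (a - b) \<le> r + s"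
  by (smt (verit) norm_triangle_ineq4)

lemma norm_scaleR_mono: "0 \<le> c \<Longrightarrow> norm a \<le> r \<Longrightarrow> norm (c *\<^sub>R a) \<le> c * r"
  by (simp add: mult_left_mono)

text \<open>Applied backwards, these rules estimate a linear combination term by term, so the stated
  bound has to mirror the shape of the vector expression.\<close>

lemmas norm_mono_intros = norm_triangle_mono norm_diff_mono norm_scaleR_mono

text \<open>\<open>A i\<close> and \<open>B i\<close> stand for the \<open>i\<close>-th time
  derivatives of \<open>F\<close> and \<open>G\<close> along the solution \<open>u\<close>. Order 4
  for both gives five derivatives of \<open>u\<close>, as a defect of order \<open>h ^ 5\<close>
  requires.\<close>

locale split_curve =
  fixes A B :: "nat \<Rightarrow> real \<Rightarrow> real^'m" and u :: "real \<Rightarrow> real^'m" and T M :: real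
  assumes A_deriv: "\<And>i t. i < 4 \<Longrightarrow> t \<in> {0..T} \<Longrightarrow> (A i has_vector_derivative A (Suc i) t) (at t within {0..T})"
    and B_deriv: "\<And>i t. i < 4 \<Longrightarrow> t \<in> {0..T} \<Longrightarrow> (B i has_vector_derivative B (Suc i) t) (at t within {0..T})"
    and u_deriv: "\<And>t. t \<in> {0..T} \<Longrightarrow> (u has_vector_derivative A 0 t + B 0 t) (at t within {0..T})"
    and A_bound: "\<And>i t. i \<le> 4 \<Longrightarrow> t \<in> {0..T} \<Longrightarrow> norm (A i t) \<le> M"
    and B_bound: "\<And>i t. i \<le> 4 \<Longrightarrow> t \<in> {0..T} \<Longrightarrow> norm (B i t) \<le> M"
begin

text \<open>The derivatives of \<open>u\<close>, rewritten by the differential equation so that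
  Taylor coefficients of \<open>u\<close> can cancel against those of \<open>A\<close> and
  \<open>B\<close>.\<close>

definition Du :: "nat \<Rightarrow> real \<Rightarrow> real^'m" where
  "Du i t = (case i of 0 \<Rightarrow> u t | Suc j \<Rightarrow> A j t + B j t)"

lemma Du_deriv:
  assumes "i < 5" "t \<in> {0..T}"
  shows "(Du i has_vector_derivative Du (Suc i) t) (at t within {0..T})"
proof (cases i)
  case 0
  then show ?thesis using u_deriv assms by (simp add: Du_def[abs_def])
next
  case (Suc j)
  then show ?thesis using A_deriv[of j t] B_deriv[of j t] assms
    by (auto simp: Du_def[abs_def] intro!: has_vector_derivative_add)
qed

lemma Du_bound: "0 < i \<Longrightarrow> i \<le> 5 \<Longrightarrow> t \<in> {0..T} \<Longrightarrow> norm (Du i t) \<le> 2 * M"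
  using A_bound[of "i - 1" t] B_bound[of "i - 1" t] norm_triangle_ineq[of "A (i - 1) t" "B (i - 1) t"]
  by (auto simp: Du_def split: nat.splits)

context
  fixes t s :: real
  assumes ts: "0 \<le> t" "0 \<le> s" "t + s \<le> T"
begin

text \<open>The remainder is controlled by the \<open>n\<close>-th derivative of \<open>u\<close>;
  \<open>M\<close> bounds only \<open>A\<close> and \<open>B\<close>, hence
  \<open>0 < n\<close>.\<close>

lemma Du_taylor: "0 < n \<Longrightarrow> n \<le> 5 \<Longrightarrow> norm (u (t + s) - (\<Sum>i<n. (s ^ i / fact i) *\<^sub>R Du i t)) \<le> 2 * M * s ^ n"
  using curve_taylor[of n T Du "2 * M" t s] Du_deriv Du_bound ts by (auto simp: Du_def)

lemma A_taylor: "k + n \<le> 4 \<Longrightarrow> norm (A k (t + s) - (\<Sum>i<n. (s ^ i / fact i) *\<^sub>R A (k + i) t)) \<le> M * s ^ n"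
  using curve_taylor[of n T "\<lambda>i. A (k + i)" M t s] A_deriv A_bound ts by auto

lemma B_taylor: "k + n \<le> 4 \<Longrightarrow> norm (B k (t + s) - (\<Sum>i<n. (s ^ i / fact i) *\<^sub>R B (k + i) t)) \<le> M * s ^ n"
  using curve_taylor[of n T "\<lambda>i. B (k + i)" M t s] B_deriv B_bound ts by auto

end

lemma M_nonneg: "0 \<le> t \<Longrightarrow> t \<le> T \<Longrightarrow> 0 \<le> M"
  using A_bound[of 0 t] norm_ge_zero[of "A 0 t"] by (simp del: norm_ge_zero)

text \<open>Expanded about \<open>t\<close>, the implicit terms give \<open>B 1 t\<close> the
  coefficient \<open>h^2/4 - h^2/8 = h^2/8\<close>, which is that of the Taylor polynomial of
  \<open>u\<close>. Only remainders of total order 3 survive.\<close>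

lemma stage_defect:
  assumes th: "0 \<le> t" "0 \<le> h" "t + h / 2 \<le> T"
  shows "norm (u (t + h / 2) - (u t + (h / 2) *\<^sub>R A 0 t + (h\<^sup>2 / 8) *\<^sub>R A 1 t
           + (h / 2) *\<^sub>R B 0 (t + h / 2) - (h\<^sup>2 / 8) *\<^sub>R B 1 (t + h / 2))) \<le> M * h ^ 3"
    (is "norm ?d \<le> _")
proof -
  define r1 where "r1 = u (t + h / 2) - (\<Sum>i<3. ((h / 2) ^ i / fact i) *\<^sub>R Du i t)"
  define r2 where "r2 = B 0 (t + h / 2) - (\<Sum>i<2. ((h / 2) ^ i / fact i) *\<^sub>R B (0 + i) t)"
  define r3 where "r3 = B 1 (t + h / 2) - (\<Sum>i<1. ((h / 2) ^ i / fact i) *\<^sub>R B (1 + i) t)"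
  have "?d = r1 - (h / 2) *\<^sub>R r2 + (h\<^sup>2 / 8) *\<^sub>R r3"
    by (simp add: vec_eq_iff r1_def r2_def r3_def Du_def eval_nat_numeral) (simp add: field_simps)
  moreover have "norm (r1 - (h / 2) *\<^sub>R r2 + (h\<^sup>2 / 8) *\<^sub>R r3)
      \<le> 2 * M * (h / 2) ^ 3 + (h / 2) * (M * (h / 2) ^ 2) + (h\<^sup>2 / 8) * (M * (h / 2) ^ 1)"
    unfolding r1_def r2_def r3_def using th
    by (intro norm_mono_intros Du_taylor B_taylor) auto
  ultimately have "norm ?d \<le> 2 * M * (h / 2) ^ 3 + (h / 2) * (M * (h / 2) ^ 2) + (h\<^sup>2 / 8) * (M * (h / 2) ^ 1)"
    by (simp only:)
  also have "\<dots> = (7 / 16) * (M * h ^ 3)" by (simp add: eval_nat_numeral)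
  also have "\<dots> \<le> M * h ^ 3" using M_nonneg[of t] th by (auto intro!: mult_nonneg_nonneg)
  finally show ?thesis .
qed

text \<open>All coefficients up to \<open>h ^ 4\<close> cancel. For instance \<open>A 3 t\<close>
  receives \<open>1/3 * 1/8 = 1/24\<close>, and \<open>B 3 t\<close> receives
  \<open>1/6 - 1/12 - 1/24 = 1/24\<close>. Each expansion is taken just far enough that its
  remainder, times its prefactor, has order 5.\<close>

lemma update_defect:
  assumes th: "0 \<le> t" "0 \<le> h" "t + h \<le> T"
  shows "norm (u (t + h) - (u t + h *\<^sub>R A 0 t + (h\<^sup>2 / 6) *\<^sub>R (A 1 t + 2 *\<^sub>R A 1 (t + h / 2))
           + h *\<^sub>R B 0 (t + h) - (h\<^sup>2 / 6) *\<^sub>R (B 1 (t + h) + 2 *\<^sub>R B 1 (t + h / 2)))) \<le> 4 * M * h ^ 5"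
    (is "norm ?d \<le> _")
proof -
  define r1 where "r1 = u (t + h) - (\<Sum>i<5. (h ^ i / fact i) *\<^sub>R Du i t)"
  define r2 where "r2 = A 1 (t + h / 2) - (\<Sum>i<3. ((h / 2) ^ i / fact i) *\<^sub>R A (1 + i) t)"
  define r3 where "r3 = B 0 (t + h) - (\<Sum>i<4. (h ^ i / fact i) *\<^sub>R B (0 + i) t)"
  define r4 where "r4 = B 1 (t + h) - (\<Sum>i<3. (h ^ i / fact i) *\<^sub>R B (1 + i) t)"
  define r5 where "r5 = B 1 (t + h / 2) - (\<Sum>i<3. ((h / 2) ^ i / fact i) *\<^sub>R B (1 + i) t)"
  have "?d = r1 - (h\<^sup>2 / 3) *\<^sub>R r2 - h *\<^sub>R r3 + (h\<^sup>2 / 6) *\<^sub>R r4 + (h\<^sup>2 / 3) *\<^sub>R r5"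
    by (simp add: vec_eq_iff r1_def r2_def r3_def r4_def r5_def Du_def eval_nat_numeral) (simp add: field_simps)
  moreover have "norm (r1 - (h\<^sup>2 / 3) *\<^sub>R r2 - h *\<^sub>R r3 + (h\<^sup>2 / 6) *\<^sub>R r4 + (h\<^sup>2 / 3) *\<^sub>R r5)
      \<le> 2 * M * h ^ 5 + (h\<^sup>2 / 3) * (M * (h / 2) ^ 3) + h * (M * h ^ 4)
      + (h\<^sup>2 / 6) * (M * h ^ 3) + (h\<^sup>2 / 3) * (M * (h / 2) ^ 3)"
    unfolding r1_def r2_def r3_def r4_def r5_def using th
    by (intro norm_mono_intros Du_taylor A_taylor B_taylor) auto
  ultimately have "norm ?d \<le> 2 * M * h ^ 5 + (h\<^sup>2 / 3) * (M * (h / 2) ^ 3) + h * (M * h ^ 4)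
      + (h\<^sup>2 / 6) * (M * h ^ 3) + (h\<^sup>2 / 3) * (M * (h / 2) ^ 3)"
    by (simp only:)
  also have "\<dots> = (13 / 4) * (M * h ^ 5)" by (simp add: eval_nat_numeral)
  also have "\<dots> \<le> 4 * M * h ^ 5" using M_nonneg[of t] th by (auto intro!: mult_nonneg_nonneg)
  finally show ?thesis .
qed

end

section \<open>Existence, uniqueness and stability of one step\<close>

text \<open>A continuous curve of fixed points starting at \<open>v\<close> cannot leave the unit ball: it would
  have to cross the unit sphere, whereas \<open>\<Phi> k\<close> maps the closed ball into the open one.\<close>

lemma implicit_branch:
  fixes \<Phi> :: "real \<Rightarrow> 'a::euclidean_space \<Rightarrow> 'a"
  assumes h: "0 \<le> h"
    and cont: "\<And>x. x \<in> cball v 1 \<Longrightarrow> continuous_on {0..h} (\<lambda>k. \<Phi> k x)"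
    and stay: "\<And>k x. k \<in> {0..h} \<Longrightarrow> x \<in> cball v 1 \<Longrightarrow> norm (\<Phi> k x - v) < 1"
    and contr: "\<And>k x y. k \<in> {0..h} \<Longrightarrow> x \<in> cball v 1 \<Longrightarrow> y \<in> cball v 1 \<Longrightarrow>
      norm (\<Phi> k x - \<Phi> k y) \<le> (1 / 2) * norm (x - y)"
    and start: "\<Phi> 0 v = v"
  obtains \<sigma> where "continuous_on {0..h} \<sigma>" "\<sigma> 0 = v"
    "\<And>k. k \<in> {0..h} \<Longrightarrow> \<sigma> k \<in> cball v 1" "\<And>k. k \<in> {0..h} \<Longrightarrow> \<sigma> k = \<Phi> k (\<sigma> k)"
    "\<And>\<tau> k. continuous_on {0..h} \<tau> \<Longrightarrow> \<tau> 0 = v \<Longrightarrow> (\<And>k. k \<in> {0<..h} \<Longrightarrow> \<tau> k = \<Phi> k (\<tau> k)) \<Longrightarrow>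
      k \<in> {0..h} \<Longrightarrow> \<tau> k = \<sigma> k"
proof -
  have "\<exists>!x\<in>cball v 1. \<Phi> k x = x" if "k \<in> {0..h}" for k
    by (rule Banach_fix[of _ "1/2"])
       (use stay[OF that] contr[OF that] in \<open>auto simp: dist_norm norm_minus_commute complete_eq_closed less_imp_le\<close>)
  then have uniq: "\<And>k x y. k \<in> {0..h} \<Longrightarrow> x \<in> cball v 1 \<Longrightarrow> y \<in> cball v 1 \<Longrightarrow> \<Phi> k x = x \<Longrightarrow> \<Phi> k y = y \<Longrightarrow> x = y"
    and "\<forall>k\<in>{0..h}. \<exists>x. x \<in> cball v 1 \<and> \<Phi> k x = x" by blast+
  then obtain \<sigma> where \<sigma>: "\<And>k. k \<in> {0..h} \<Longrightarrow> \<sigma> k \<in> cball v 1" "\<And>k. k \<in> {0..h} \<Longrightarrow> \<Phi> k (\<sigma> k) = \<sigma> k"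
    by metis
  have \<sigma>0: "\<sigma> 0 = v" using uniq[of 0 "\<sigma> 0" v] \<sigma>[of 0] start h by auto
  have lip: "norm (\<sigma> k - \<sigma> l) \<le> 2 * norm (\<Phi> k (\<sigma> l) - \<Phi> l (\<sigma> l))" if "k \<in> {0..h}" "l \<in> {0..h}" for k l
  proof -
    have "norm (\<sigma> k - \<sigma> l) = norm ((\<Phi> k (\<sigma> k) - \<Phi> k (\<sigma> l)) + (\<Phi> k (\<sigma> l) - \<Phi> l (\<sigma> l)))"
      using \<sigma> that by simp
    also have "\<dots> \<le> (1 / 2) * norm (\<sigma> k - \<sigma> l) + norm (\<Phi> k (\<sigma> l) - \<Phi> l (\<sigma> l))"
      using \<sigma> that by (intro norm_triangle_mono contr order_refl) auto
    finally show ?thesis by simp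
  qed
  have cont\<sigma>: "continuous_on {0..h} \<sigma>"
    unfolding continuous_on_iff
  proof (intro ballI allI impI)
    fix l e :: real assume l: "l \<in> {0..h}" and "0 < e"
    then obtain d where "d > 0" "\<forall>k\<in>{0..h}. dist k l < d \<longrightarrow> dist (\<Phi> k (\<sigma> l)) (\<Phi> l (\<sigma> l)) < e / 2"
      using cont[OF \<sigma>(1)[OF l]] unfolding continuous_on_iff by (metis half_gt_zero)
    then show "\<exists>d>0. \<forall>k\<in>{0..h}. dist k l < d \<longrightarrow> dist (\<sigma> k) (\<sigma> l) < e"
      using lip[OF _ l] by (intro exI[of _ d]) (force simp: dist_norm)
  qed
  have "\<tau> k = \<sigma> k" if \<tau>: "continuous_on {0..h} \<tau>" "\<tau> 0 = v" "\<And>k. k \<in> {0<..h} \<Longrightarrow> \<tau> k = \<Phi> k (\<tau> k)"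
    and k: "k \<in> {0..h}" for \<tau> k
  \<comment> \<open>The equation for \<open>\<tau>\<close> is given only at positive parameters; at
    0 the value is prescribed.\<close>
  proof (cases "k = 0")
    case False
    have "\<tau> k \<in> cball v 1"
    proof (rule ccontr)
      assume "\<tau> k \<notin> cball v 1"
      then have "1 \<le> norm (\<tau> k - v)" by (simp add: dist_norm norm_minus_commute)
      moreover have "continuous_on {0..k} (\<lambda>k. norm (\<tau> k - v))"
        using k by (intro continuous_intros continuous_on_subset[OF \<tau>(1)]) auto
      ultimately obtain l where l: "0 \<le> l" "l \<le> k" "norm (\<tau> l - v) = 1"
        using IVT'[of "\<lambda>k. norm (\<tau> k - v)" 0 1 k] \<tau>(2) k by auto
      then have "l \<in> {0<..h}" "\<tau> l \<in> cball v 1" using k \<tau>(2)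
        by (auto simp: dist_norm norm_minus_commute order_le_less)
      then show False using stay[of l "\<tau> l"] \<tau>(3)[of l] l by auto
    qed
    then show ?thesis using uniq[of k "\<tau> k" "\<sigma> k"] \<tau>(3)[of k] \<sigma> k False by auto
  qed (simp add: \<tau> \<sigma>0)
  with cont\<sigma> \<sigma>0 \<sigma> that show thesis by metis
qed

text \<open>\<open>R\<close> is meant to bound the exact solution. One unit of the radius
  \<open>R + 2\<close> allows for the error of an iterate, the other for the distance of the stage
  and the next iterate from it.\<close>

locale lipschitz_split =
  fixes F G :: "real^'m \<Rightarrow> real^'m" and L R :: real
  assumes L_ge_1: "1 \<le> L"
    and field_bound: "\<And>H x. H \<in> {F, G, time_deriv F G F, time_deriv F G G} \<Longrightarrow>
      x \<in> cball 0 (R + 2) \<Longrightarrow> norm (H x) \<le> L"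
    and field_lipschitz: "\<And>H. H \<in> {F, G, time_deriv F G F, time_deriv F G G} \<Longrightarrow>
      L-lipschitz_on (cball 0 (R + 2)) H"
begin

abbreviation "K \<equiv> cball (0::real^'m) (R + 2)"

abbreviation "F' \<equiv> time_deriv F G F"
abbreviation "G' \<equiv> time_deriv F G G"

lemma norm_field_diff_le:
  assumes "x \<in> K" "y \<in> K"
  shows "norm (F x - F y) \<le> L * norm (x - y)" "norm (G x - G y) \<le> L * norm (x - y)"
    "norm (F' x - F' y) \<le> L * norm (x - y)" "norm (G' x - G' y) \<le> L * norm (x - y)"
  using field_lipschitz[THEN lipschitz_on_normD, of _ x y] assms by auto

lemma norm_field_le:
  assumes "x \<in> K"
  shows "norm (F x) \<le> L" "norm (G x) \<le> L" "norm (F' x) \<le> L" "norm (G' x) \<le> L"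
  using field_bound assms by auto

lemma cball_subset_K: "v \<in> cball 0 (R + 1) \<Longrightarrow> cball v 1 \<subseteq> K"
  by (auto simp: cball_subset_cball_iff dist_norm)

text \<open>Because \<open>1 \<le> L\<close>, the one condition also bounds \<open>k\<close> itself,
  so terms with \<open>k ^ 2\<close> are dominated by a quarter of those with \<open>k\<close>. The
  products serve as atoms for linear arithmetic.\<close>

lemma small_step:
  assumes "0 \<le> k" "4 * L * k \<le> 1"
  shows "k \<le> 1 / 4" "k * L \<le> 1 / 4" "0 \<le> k * L" "0 \<le> k\<^sup>2 * L" "k\<^sup>2 * L \<le> k * L / 4"
proof -
  show kL: "k * L \<le> 1 / 4" "0 \<le> k * L" "0 \<le> k\<^sup>2 * L" using assms L_ge_1 by (auto simp: mult_ac)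
  have "k * 1 \<le> k * L" using assms L_ge_1 by (intro mult_left_mono) auto
  with kL show k: "k \<le> 1 / 4" by simp
  show "k\<^sup>2 * L \<le> k * L / 4"
    using mult_right_mono[OF k kL(2)] by (simp add: power2_eq_square)
qed

text \<open>\<open>implicit_branch\<close> is used twice: for the stage, then for the update with
  the stage branch inserted. Its uniqueness part applies to the curves in the definition of
  \<open>step\<close>.\<close>

lemma step_solution:
  assumes v: "v \<in> cball 0 (R + 1)" and h: "0 < h" "4 * L * h \<le> 1"
  obtains s w where "step F G h v s w" "s \<in> cball v 1" "w \<in> cball v 1"
    "\<And>s' w'. step F G h v s' w' \<Longrightarrow> s' = s \<and> w' = w"
proof -
  define \<Phi> where "\<Phi> k s = v + (k / 2) *\<^sub>R F v + (k\<^sup>2 / 8) *\<^sub>R F' v + (k / 2) *\<^sub>R G s - (k\<^sup>2 / 8) *\<^sub>R G' s" for k s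
  have K: "x \<in> K" if "x \<in> cball v 1" for x using that cball_subset_K[OF v] by blast
  have vK: "v \<in> K" using K by simp
  \<comment> \<open>The branches are followed from 0 up to \<open>h\<close>, so the smallness
    conditions are needed at every intermediate step size.\<close>
  have small: "k \<le> 1 / 4" "k * L \<le> 1 / 4" "0 \<le> k * L" "0 \<le> k\<^sup>2 * L" "k\<^sup>2 * L \<le> k * L / 4"
    if "k \<in> {0..h}" for k
  proof -
    have "4 * L * k \<le> 4 * L * h" using that L_ge_1 by (intro mult_left_mono) auto
    with h have "4 * L * k \<le> 1" by simp
    with that show "k \<le> 1 / 4" "k * L \<le> 1 / 4" "0 \<le> k * L" "0 \<le> k\<^sup>2 * L" "k\<^sup>2 * L \<le> k * L / 4"
      using small_step[of k] by auto
  qed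
  obtain \<sigma> where \<sigma>: "continuous_on {0..h} \<sigma>" "\<sigma> 0 = v"
      "\<And>k. k \<in> {0..h} \<Longrightarrow> \<sigma> k \<in> cball v 1" "\<And>k. k \<in> {0..h} \<Longrightarrow> \<sigma> k = \<Phi> k (\<sigma> k)"
      "\<And>\<tau> k. continuous_on {0..h} \<tau> \<Longrightarrow> \<tau> 0 = v \<Longrightarrow> (\<And>k. k \<in> {0<..h} \<Longrightarrow> \<tau> k = \<Phi> k (\<tau> k)) \<Longrightarrow>
        k \<in> {0..h} \<Longrightarrow> \<tau> k = \<sigma> k"
  proof (rule implicit_branch[of h v \<Phi>])
    show "0 \<le> h" "\<Phi> 0 v = v" using h by (auto simp: \<Phi>_def)
    show "continuous_on {0..h} (\<lambda>k. \<Phi> k x)" for x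
      unfolding \<Phi>_def by (intro continuous_intros) auto
    fix k x y assume k: "k \<in> {0..h}" and x: "x \<in> cball v 1"
    have "\<Phi> k x - v = (k / 2) *\<^sub>R F v + (k\<^sup>2 / 8) *\<^sub>R F' v + (k / 2) *\<^sub>R G x - (k\<^sup>2 / 8) *\<^sub>R G' x"
      by (simp add: \<Phi>_def)
    also have "norm \<dots> \<le> (k / 2) * L + (k\<^sup>2 / 8) * L + (k / 2) * L + (k\<^sup>2 / 8) * L"
      using k x K vK by (intro norm_mono_intros norm_field_le) auto
    also have "\<dots> < 1" using small[OF k] by (simp add: mult.commute[of L])
    finally show "norm (\<Phi> k x - v) < 1" .
    assume y: "y \<in> cball v 1"
    have "\<Phi> k x - \<Phi> k y = (k / 2) *\<^sub>R (G x - G y) - (k\<^sup>2 / 8) *\<^sub>R (G' x - G' y)"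
      by (simp add: \<Phi>_def algebra_simps)
    also have "norm \<dots> \<le> (k / 2) * (L * norm (x - y)) + (k\<^sup>2 / 8) * (L * norm (x - y))"
      using k x y K by (intro norm_mono_intros norm_field_diff_le) auto
    also have "\<dots> = (k * L / 2 + k\<^sup>2 * L / 8) * norm (x - y)" by (simp add: algebra_simps)
    also have "\<dots> \<le> (1 / 2) * norm (x - y)"
      using small[OF k] by (intro mult_right_mono) (auto simp: mult.commute[of L])
    finally show "norm (\<Phi> k x - \<Phi> k y) \<le> (1 / 2) * norm (x - y)" .
  qed blast
  \<comment> \<open>The stage branch enters as a known function of \<open>k\<close>, so continuity
    of \<open>\<Psi>\<close> in \<open>k\<close> rests on that of \<open>\<sigma>\<close>.\<close>
  define \<Psi> where "\<Psi> k w = v + k *\<^sub>R F v + (k\<^sup>2 / 6) *\<^sub>R (F' v + 2 *\<^sub>R F' (\<sigma> k)) + k *\<^sub>R G w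
      - (k\<^sup>2 / 6) *\<^sub>R (G' w + 2 *\<^sub>R G' (\<sigma> k))" for k w
  have contF': "continuous_on K F'" "continuous_on K G'"
    using field_lipschitz lipschitz_on_continuous_on by blast+
  have cont\<sigma>: "continuous_on {0..h} (\<lambda>k. F' (\<sigma> k))" "continuous_on {0..h} (\<lambda>k. G' (\<sigma> k))"
    using \<sigma>(3) K by (auto intro!: continuous_on_compose2[OF contF'(1) \<sigma>(1)] continuous_on_compose2[OF contF'(2) \<sigma>(1)]
        simp del: mem_cball)
  obtain \<omega> where \<omega>: "continuous_on {0..h} \<omega>" "\<omega> 0 = v"
      "\<And>k. k \<in> {0..h} \<Longrightarrow> \<omega> k \<in> cball v 1" "\<And>k. k \<in> {0..h} \<Longrightarrow> \<omega> k = \<Psi> k (\<omega> k)"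
      "\<And>\<tau> k. continuous_on {0..h} \<tau> \<Longrightarrow> \<tau> 0 = v \<Longrightarrow> (\<And>k. k \<in> {0<..h} \<Longrightarrow> \<tau> k = \<Psi> k (\<tau> k)) \<Longrightarrow>
        k \<in> {0..h} \<Longrightarrow> \<tau> k = \<omega> k"
  proof (rule implicit_branch[of h v \<Psi>])
    show "0 \<le> h" "\<Psi> 0 v = v" using h by (auto simp: \<Psi>_def)
    show "continuous_on {0..h} (\<lambda>k. \<Psi> k x)" for x
      unfolding \<Psi>_def by (intro continuous_intros cont\<sigma>) auto
    fix k x y assume k: "k \<in> {0..h}" and x: "x \<in> cball v 1"
    have \<sigma>K: "\<sigma> k \<in> K" using \<sigma>(3)[OF k] K by blast
    have "\<Psi> k x - v = k *\<^sub>R F v + (k\<^sup>2 / 6) *\<^sub>R (F' v + 2 *\<^sub>R F' (\<sigma> k)) + k *\<^sub>R G x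
        - (k\<^sup>2 / 6) *\<^sub>R (G' x + 2 *\<^sub>R G' (\<sigma> k))"
      by (simp add: \<Psi>_def)
    also have "norm \<dots> \<le> k * L + (k\<^sup>2 / 6) * (L + 2 * L) + k * L + (k\<^sup>2 / 6) * (L + 2 * L)"
      using k x K vK \<sigma>K by (intro norm_mono_intros norm_field_le) auto
    also have "\<dots> < 1" using small[OF k] by (simp add: mult.commute[of L])
    finally show "norm (\<Psi> k x - v) < 1" .
    assume y: "y \<in> cball v 1"
    have "\<Psi> k x - \<Psi> k y = k *\<^sub>R (G x - G y) - (k\<^sup>2 / 6) *\<^sub>R (G' x - G' y)"
      by (simp add: \<Psi>_def algebra_simps)
    also have "norm \<dots> \<le> k * (L * norm (x - y)) + (k\<^sup>2 / 6) * (L * norm (x - y))"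
      using k x y K by (intro norm_mono_intros norm_field_diff_le) auto
    also have "\<dots> = (k * L + k\<^sup>2 * L / 6) * norm (x - y)" by (simp add: algebra_simps)
    also have "\<dots> \<le> (1 / 2) * norm (x - y)"
      using small[OF k] by (intro mult_right_mono) (auto simp: mult.commute[of L])
    finally show "norm (\<Psi> k x - \<Psi> k y) \<le> (1 / 2) * norm (x - y)" .
  qed blast
  have stage: "stage_eq F G k v s \<longleftrightarrow> s = \<Phi> k s" for k s by (simp add: stage_eq_def \<Phi>_def)
  have update: "update_eq F G k v (\<sigma> k) w \<longleftrightarrow> w = \<Psi> k w" for k w by (simp add: update_eq_def \<Psi>_def)
  show thesis
  proof (rule that[of "\<sigma> h" "\<omega> h"])
    show "step F G h v (\<sigma> h) (\<omega> h)"
      unfolding step_def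
      by (rule exI[of _ \<sigma>], rule exI[of _ \<omega>]) (use \<sigma>(1,2,4) \<omega>(1,2,4) in \<open>auto simp: stage update\<close>)
    show "\<sigma> h \<in> cball v 1" "\<omega> h \<in> cball v 1" using \<sigma>(3) \<omega>(3) h by auto
    fix s w assume "step F G h v s w"
    then obtain \<sigma>' \<omega>' where c: "continuous_on {0..h} \<sigma>'" "continuous_on {0..h} \<omega>'" "\<sigma>' 0 = v" "\<omega>' 0 = v"
      "\<And>k. k \<in> {0<..h} \<Longrightarrow> stage_eq F G k v (\<sigma>' k)"
      "\<And>k. k \<in> {0<..h} \<Longrightarrow> update_eq F G k v (\<sigma>' k) (\<omega>' k)"
      "s = \<sigma>' h" "w = \<omega>' h"
      unfolding step_def by blast
    \<comment> \<open>Agreement on the whole interval, not only at \<open>h\<close>, is what makes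
      \<open>\<omega>'\<close> a curve of fixed points of \<open>\<Psi>\<close>.\<close>
    have \<sigma>': "\<sigma>' k = \<sigma> k" if "k \<in> {0..h}" for k
      using \<sigma>(5)[OF c(1,3) _ that] c(5) stage by blast
    have "\<omega>' k = \<Psi> k (\<omega>' k)" if "k \<in> {0<..h}" for k
      using c(6)[OF that] \<sigma>'[of k] that update by simp
    then have "\<omega>' h = \<omega> h" using \<omega>(5)[OF c(2,4), of h] h by simp
    with \<sigma>' c h show "s = \<sigma> h \<and> w = \<omega> h" by simp
  qed
qed

lemma step_equations:
  "step F G h v s w \<Longrightarrow> 0 < h \<Longrightarrow> stage_eq F G h v s \<and> update_eq F G h v s w"
  unfolding step_def by auto

text \<open>The primed points solve the equations up to defects; they will be values of the exact
  solution. Subtracting the equations bounds first the stage error, then the update error, and each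
  time the implicit contribution is absorbed on the left.\<close>

lemma step_stability:
  assumes K: "v \<in> K" "s \<in> K" "w \<in> K" "v' \<in> K" "s' \<in> K" "w' \<in> K"
    and h: "0 \<le> h" "4 * L * h \<le> 1" and C: "0 \<le> C"
    and eqs: "stage_eq F G h v s" "update_eq F G h v s w"
    and stage': "norm (s' - (v' + (h / 2) *\<^sub>R F v' + (h\<^sup>2 / 8) *\<^sub>R F' v'
           + (h / 2) *\<^sub>R G s' - (h\<^sup>2 / 8) *\<^sub>R G' s')) \<le> C * h ^ 3" (is "norm ?d1 \<le> _")
    and update': "norm (w' - (v' + h *\<^sub>R F v' + (h\<^sup>2 / 6) *\<^sub>R (F' v' + 2 *\<^sub>R F' s')
           + h *\<^sub>R G w' - (h\<^sup>2 / 6) *\<^sub>R (G' w' + 2 *\<^sub>R G' s'))) \<le> C * h ^ 5" (is "norm ?d2 \<le> _")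
  shows "norm (w - w') \<le> (1 + 4 * L * h) * norm (v - v') + 2 * C * (1 + 2 * L) * h ^ 5"
proof -
  define a where "a = h * L"
  define b where "b = h\<^sup>2 * L"
  define e where "e = norm (v - v')"
  define es where "es = norm (s - s')"
  define ew where "ew = norm (w - w')"
  define c where "c = C * h ^ 3"
  note small = small_step[OF h, folded a_def b_def]
  have nonneg: "0 \<le> e" "0 \<le> es" "0 \<le> ew" "0 \<le> c" using h C by (auto simp: e_def es_def ew_def c_def)
  note defs = a_def b_def e_def es_def ew_def c_def
  have "s - s' = (v - v') + (h / 2) *\<^sub>R (F v - F v') + (h\<^sup>2 / 8) *\<^sub>R (F' v - F' v')
      + (h / 2) *\<^sub>R (G s - G s') - (h\<^sup>2 / 8) *\<^sub>R (G' s - G' s') - ?d1" (is "_ = ?X")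
    by (subst eqs(1)[unfolded stage_eq_def]) (simp add: algebra_simps)
  moreover have "norm ?X \<le> e + (h / 2) * (L * e) + (h\<^sup>2 / 8) * (L * e) + (h / 2) * (L * es)
      + (h\<^sup>2 / 8) * (L * es) + c"
    unfolding defs using K h stage' by (intro norm_mono_intros norm_field_diff_le) auto
  moreover have "\<dots> = e + a / 2 * e + b / 8 * e + (a / 2 + b / 8) * es + c"
    by (simp add: a_def b_def algebra_simps)
  ultimately have "es \<le> e + a / 2 * e + b / 8 * e + (a / 2 + b / 8) * es + c"
    by (simp only: es_def)
  moreover have "a / 2 * e \<le> 1 / 8 * e" "b / 8 * e \<le> 1 / 128 * e" "(a / 2 + b / 8) * es \<le> (1 / 8 + 1 / 128) * es"
    using small nonneg by (intro mult_right_mono; linarith)+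
  \<comment> \<open>The coefficient of \<open>es\<close> on the right is at most 17/128, so
    absorbing it costs less than a factor 2.\<close>
  ultimately have es: "es \<le> 2 * e + 2 * c" using nonneg by simp
  have "w - w' = (v - v') + h *\<^sub>R (F v - F v') + (h\<^sup>2 / 6) *\<^sub>R ((F' v - F' v') + 2 *\<^sub>R (F' s - F' s'))
      + h *\<^sub>R (G w - G w') - (h\<^sup>2 / 6) *\<^sub>R ((G' w - G' w') + 2 *\<^sub>R (G' s - G' s')) - ?d2" (is "_ = ?Y")
    by (subst eqs(2)[unfolded update_eq_def]) (simp add: algebra_simps)
  moreover have "norm ?Y \<le> e + h * (L * e) + (h\<^sup>2 / 6) * (L * e + 2 * (L * es)) + h * (L * ew)
      + (h\<^sup>2 / 6) * (L * ew + 2 * (L * es)) + C * h ^ 5"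
    unfolding defs using K h update' by (intro norm_mono_intros norm_field_diff_le) auto
  moreover have "\<dots> = e + a * e + b * e / 6 + (a + b / 6) * ew + 2 / 3 * (b * es) + C * h ^ 5"
    by (simp add: a_def b_def algebra_simps)
  ultimately have "ew \<le> e + a * e + b * e / 6 + (a + b / 6) * ew + 2 / 3 * (b * es) + C * h ^ 5"
    by (simp only: ew_def)
  moreover have "b * es \<le> b * (2 * e + 2 * c)" using es small by (intro mult_left_mono) auto
  moreover have "b * e \<le> (a / 4) * e" "(a + b / 6) * ew \<le> (25 / 24 * a) * ew"
    using small nonneg by (intro mult_right_mono; linarith)+
  \<comment> \<open>The factor 33/24 comes from \<open>a * e + b * e / 6 + 4 / 3 * (b * e)\<close>
    and \<open>b \<le> a / 4\<close>.\<close>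
  ultimately have "ew \<le> e + (33 / 24) * (a * e) + 25 / 24 * (a * ew) + 4 / 3 * (b * c) + C * h ^ 5"
    by (simp add: algebra_simps)
  \<comment> \<open>The factor \<open>h ^ 2\<close> in front of the stage raises its third-order
    defect to order 5.\<close>
  also have "b * c = L * C * h ^ 5" by (simp add: b_def c_def eval_nat_numeral)
  finally have *: "ew \<le> e + (33 / 24) * (a * e) + 25 / 24 * (a * ew) + C * (1 + 4 / 3 * L) * h ^ 5"
    by (simp add: algebra_simps)
  define X where "X = C * (1 + 4 / 3 * L) * h ^ 5"
  have X: "0 \<le> X" using C h L_ge_1 by (auto simp: X_def intro!: mult_nonneg_nonneg)
  have "(1 - 25 / 24 * a) * ew \<le> (1 + 33 / 24 * a) * e + X"
    using * by (simp add: X_def algebra_simps)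
  \<comment> \<open>The right side is arranged to be divisible by \<open>1 - 25 / 24 * a\<close>,
    which is at least 1/2 because \<open>a \<le> 1 / 4\<close>.\<close>
  also have "\<dots> \<le> (1 - 25 / 24 * a) * (1 + 4 * a) * e + (1 - 25 / 24 * a) * 2 * X"
  proof (intro add_mono)
    have "0 \<le> a * (38 / 24 - 100 / 24 * a)" using small by (intro mult_nonneg_nonneg) auto
    also have "\<dots> = (1 - 25 / 24 * a) * (1 + 4 * a) - (1 + 33 / 24 * a)" by (simp add: field_simps)
    finally have "1 + 33 / 24 * a \<le> (1 - 25 / 24 * a) * (1 + 4 * a)" by simp
    then show "(1 + 33 / 24 * a) * e \<le> (1 - 25 / 24 * a) * (1 + 4 * a) * e" using nonneg by (intro mult_right_mono)
    have "1 * X \<le> (1 - 25 / 24 * a) * 2 * X" using X small by (intro mult_right_mono) auto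
    then show "X \<le> (1 - 25 / 24 * a) * 2 * X" by simp
  qed
  also have "\<dots> = (1 - 25 / 24 * a) * ((1 + 4 * a) * e + 2 * X)"
    by (simp only: mult.assoc) (simp only: distrib_left)
  finally have "ew \<le> (1 + 4 * a) * e + 2 * X" using small by simp
  also have "2 * X \<le> 2 * C * (1 + 2 * L) * h ^ 5"
    using C h L_ge_1 by (auto simp: X_def mult.assoc intro!: mult_left_mono mult_right_mono)
  finally show ?thesis by (simp add: ew_def e_def a_def mult_ac)
qed

end

section \<open>Maps of class \<open>C\<^sup>k\<close> on compact sets\<close>

lemma Ck_on_imp_continuous_on: "Ck_on k S f \<Longrightarrow> continuous_on S f"
  by (cases k) (auto intro: differentiable_imp_continuous_on)

lemma Ck_on_SucD: "Ck_on (Suc k) S f \<Longrightarrow> Ck_on k S f"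
proof (induction k arbitrary: f)
  case 0
  then show ?case using differentiable_imp_continuous_on by auto
next
  case (Suc k)
  then have "f differentiable_on S" "\<And>d. Ck_on (Suc k) S (\<lambda>x. frechet_derivative f (at x within S) d)"
    by (simp_all only: Ck_on.simps(2)[of "Suc k"])
  with Suc.IH show ?case by (subst Ck_on.simps(2)) blast
qed

lemma Ck_on_mono: "Ck_on k S f \<Longrightarrow> j \<le> k \<Longrightarrow> Ck_on j S f"
  by (induction k) (auto simp: le_Suc_eq simp del: Ck_on.simps dest: Ck_on_SucD)

text \<open>Compactness bounds the derivative along each basis vector, hence its operator norm;
  convexity then gives the Lipschitz bound. \<open>max 0 M\<close> keeps the constant nonnegative
  even for empty \<open>K\<close>.\<close>

lemma Ck_on_lipschitz_on:
  fixes f :: "'a::euclidean_space \<Rightarrow> 'b::euclidean_space"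
  assumes f: "Ck_on (Suc k) UNIV f" and K: "compact K" "convex K"
  shows "\<exists>L. L-lipschitz_on K f"
proof -
  let ?D = "\<lambda>x. frechet_derivative f (at x)"
  have f': "(f has_derivative ?D x) (at x within X)" for x X
    using Ck_on_UNIV_derivative[OF f] .
  have "continuous_on K (\<lambda>x. ?D x b)" for b
    using f Ck_on_imp_continuous_on[of k UNIV "\<lambda>x. ?D x b"] by (auto intro: continuous_on_subset)
  then obtain M where M: "\<And>b x. b \<in> Basis \<Longrightarrow> x \<in> K \<Longrightarrow> norm (?D x b) \<le> M"
    using compact_common_bound[OF K(1) finite_Basis, of "\<lambda>b x. ?D x b"] by metis
  define C where "C = real DIM('a) * max 0 M"
  have "norm (?D x v) \<le> C * norm v" if "x \<in> K" for x v
  proof -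
    have "norm (?D x v) = norm (\<Sum>b\<in>Basis. (v \<bullet> b) *\<^sub>R ?D x b)"
      using linear_expansion[OF has_derivative_linear[OF f']] by metis
    also have "\<dots> \<le> (\<Sum>b\<in>(Basis::'a set). norm v * max 0 M)"
      using M[OF _ that]
      by (intro sum_norm_le) (auto intro!: mult_mono simp: Basis_le_norm le_max_iff_disj)
    finally show ?thesis by (simp add: C_def mult_ac)
  qed
  then have "onorm (?D x) \<le> C" if "x \<in> K" for x
    using that by (intro onorm_le) auto
  then have "C-lipschitz_on K f"
    using K f' by (intro bounded_derivative_imp_lipschitz) (auto simp: C_def)
  then show ?thesis ..
qed

text \<open>The difference of products is split as
  \<open>a x *\<^sub>R (g x - g y) + (a x - a y) *\<^sub>R g y\<close>, with the undifferenced
  factors bounded by compactness.\<close>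

lemma lipschitz_on_scaleR_bounded:
  fixes g :: "'a::metric_space \<Rightarrow> 'b::real_normed_vector" and a :: "'a \<Rightarrow> real"
  assumes K: "compact K" and a: "A-lipschitz_on K a" and g: "B-lipschitz_on K g"
  shows "\<exists>L. L-lipschitz_on K (\<lambda>x. a x *\<^sub>R g x)"
proof -
  obtain P where P: "\<And>x. x \<in> K \<Longrightarrow> norm (a x) \<le> P"
    using compact_common_bound[OF K, of "{()}" "\<lambda>_. a"] lipschitz_on_continuous_on[OF a] by auto
  obtain Q where Q: "\<And>x. x \<in> K \<Longrightarrow> norm (g x) \<le> Q"
    using compact_common_bound[OF K, of "{()}" "\<lambda>_. g"] lipschitz_on_continuous_on[OF g] by auto
  note nonneg = lipschitz_on_nonneg[OF a] lipschitz_on_nonneg[OF g]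
  have "(max 0 P * B + A * max 0 Q)-lipschitz_on K (\<lambda>x. a x *\<^sub>R g x)"
  proof (rule lipschitz_onI)
    fix x y assume xy: "x \<in> K" "y \<in> K"
    have "dist (a x *\<^sub>R g x) (a y *\<^sub>R g y) = norm (a x *\<^sub>R (g x - g y) + (a x - a y) *\<^sub>R g y)"
      by (simp add: dist_norm algebra_simps)
    also have "\<dots> \<le> \<bar>a x\<bar> * dist (g x) (g y) + dist (a x) (a y) * norm (g y)"
      by (metis dist_norm norm_scaleR norm_triangle_ineq real_norm_def)
    also have "\<dots> \<le> max 0 P * (B * dist x y) + (A * dist x y) * max 0 Q"
      using P[OF xy(1)] Q[OF xy(2)] lipschitz_onD[OF a xy] lipschitz_onD[OF g xy] nonneg
      by (intro add_mono mult_mono) auto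
    finally show "dist (a x *\<^sub>R g x) (a y *\<^sub>R g y) \<le> (max 0 P * B + A * max 0 Q) * dist x y"
      by (simp add: algebra_simps)
  qed (use nonneg in auto)
  then show ?thesis ..
qed

lemma lipschitz_on_sum:
  fixes f :: "'i \<Rightarrow> 'a::metric_space \<Rightarrow> 'b::real_normed_vector"
  assumes "finite I" "\<And>i. i \<in> I \<Longrightarrow> \<exists>L. L-lipschitz_on K (f i)"
  shows "\<exists>L. L-lipschitz_on K (\<lambda>x. \<Sum>i\<in>I. f i x)"
  using assms
proof (induction I rule: finite_induct)
  case empty
  then show ?case using lipschitz_on_constant by auto
next
  case (insert i I)
  then obtain A B where "A-lipschitz_on K (f i)" "B-lipschitz_on K (\<lambda>x. \<Sum>i\<in>I. f i x)" by blast
  from lipschitz_on_add[OF this] insert.hyps show ?case by auto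
qed

lemma lipschitz_on_common_constant:
  assumes "finite \<H>" "\<And>f. f \<in> \<H> \<Longrightarrow> \<exists>L. L-lipschitz_on K f"
  shows "\<exists>L. \<forall>f\<in>\<H>. L-lipschitz_on K f"
  using assms
proof (induction \<H> rule: finite_induct)
  case (insert f \<H>)
  then obtain A B where "A-lipschitz_on K f" "\<forall>f\<in>\<H>. B-lipschitz_on K f" by blast
  then show ?case
    by (intro exI[of _ "max A B"]) (auto intro: lipschitz_on_mono[OF _ order_refl])
qed simp

text \<open>The Jacobian is the matrix of the derivative, and linearity recovers the derivative from
  it. This links the scheme to \<open>Ck_on\<close>.\<close>

lemma time_deriv_frechet:
  fixes H :: "real^'m \<Rightarrow> real^'m"
  assumes "Ck_on (Suc k) UNIV H"
  shows "time_deriv F G H v = frechet_derivative H (at v) (F v + G v)"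
proof -
  have "linear (frechet_derivative H (at v))"
    using has_derivative_linear[OF Ck_on_UNIV_derivative[OF assms]] .
  then show ?thesis by (simp add: time_deriv_def jacobian_def matrix_works)
qed

text \<open>In the basis expansion each summand is a coordinate of \<open>F + G\<close> times a
  directional derivative of \<open>H\<close>. The latter is Lipschitz thanks to the second
  derivative of \<open>H\<close>.\<close>

lemma time_deriv_lipschitz_on:
  fixes F G H :: "real^'m \<Rightarrow> real^'m"
  assumes C: "Ck_on (Suc i) UNIV F" "Ck_on (Suc j) UNIV G" "Ck_on (Suc (Suc k)) UNIV H"
    and K: "compact K" "convex K"
  shows "\<exists>L. L-lipschitz_on K (time_deriv F G H)"
proof -
  let ?D = "\<lambda>x. frechet_derivative H (at x)"
  obtain A B where "A-lipschitz_on K F" "B-lipschitz_on K G"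
    using Ck_on_lipschitz_on C K by metis
  from lipschitz_on_add[OF this] have FG: "(A + B)-lipschitz_on K (\<lambda>x. F x + G x)" .
  have "\<exists>L. L-lipschitz_on K (\<lambda>x. ((F x + G x) \<bullet> b) *\<^sub>R ?D x b)" if "b \<in> Basis" for b
  proof -
    have "1-lipschitz_on ((\<lambda>x. F x + G x) ` K) (\<lambda>y. y \<bullet> b)"
      using that by (intro lipschitz_onI)
        (auto simp: dist_norm inner_diff_left[symmetric] Basis_le_norm simp del: inner_diff_left)
    from lipschitz_on_compose2[OF FG this]
    have "(1 * (A + B))-lipschitz_on K (\<lambda>x. (F x + G x) \<bullet> b)" .
    moreover obtain M where "M-lipschitz_on K (\<lambda>x. ?D x b)"
      using Ck_on_lipschitz_on[of k "\<lambda>x. ?D x b", OF _ K] C(3)[unfolded Ck_on.simps(2)[of "Suc k"]] by blast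
    ultimately show ?thesis by (rule lipschitz_on_scaleR_bounded[OF K(1)])
  qed
  from lipschitz_on_sum[OF finite_Basis this]
  have "\<exists>L. L-lipschitz_on K (\<lambda>x. \<Sum>b\<in>Basis. ((F x + G x) \<bullet> b) *\<^sub>R ?D x b)" .
  moreover have "time_deriv F G H x = (\<Sum>b\<in>Basis. ((F x + G x) \<bullet> b) *\<^sub>R ?D x b)" for x
    unfolding time_deriv_frechet[OF C(3)]
    by (rule linear_expansion[OF has_derivative_linear[OF Ck_on_UNIV_derivative[OF C(3)]]])
  ultimately show ?thesis by (simp add: fun_eq_iff[symmetric])
qed

lemma lipschitz_split_exists:
  fixes F G :: "real^'m \<Rightarrow> real^'m"
  assumes "Ck_on (Suc (Suc j)) UNIV F" "Ck_on (Suc (Suc k)) UNIV G"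
  obtains L where "lipschitz_split F G L R"
proof -
  let ?K = "cball (0::real^'m) (R + 2)"
  let ?H = "{F, G, time_deriv F G F, time_deriv F G G}"
  have K: "compact ?K" "convex ?K" by auto
  have C: "Ck_on (Suc j) UNIV F" "Ck_on (Suc k) UNIV G" using assms Ck_on_SucD by blast+
  have "\<exists>L. L-lipschitz_on ?K H" if "H \<in> ?H" for H
    using that Ck_on_lipschitz_on[OF C(1) K] Ck_on_lipschitz_on[OF C(2) K]
      time_deriv_lipschitz_on[OF C assms(1) K] time_deriv_lipschitz_on[OF C assms(2) K] by blast
  then obtain L where L: "\<And>H. H \<in> ?H \<Longrightarrow> L-lipschitz_on ?K H"
    using lipschitz_on_common_constant[of ?H ?K] by blast
  obtain M where M: "\<And>H x. H \<in> ?H \<Longrightarrow> x \<in> ?K \<Longrightarrow> norm (H x) \<le> M"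
    using compact_common_bound[OF K(1), of ?H "\<lambda>H. H"] L lipschitz_on_continuous_on by blast
  have "lipschitz_split F G (max 1 (max L M)) R"
  proof
    fix H assume H: "H \<in> ?H"
    show "(max 1 (max L M))-lipschitz_on ?K H"
      by (rule lipschitz_on_mono[OF L[OF H]]) auto
    fix x assume "x \<in> ?K"
    from M[OF H this] show "norm (H x) \<le> max 1 (max L M)" by linarith
  qed simp
  then show thesis by (rule that)
qed

text \<open>Bootstrapping: if \<open>u\<close> has order \<open>k\<close>, so has the right-hand
  side of the equation, and \<open>u\<close> gains one order. Composing \<open>F\<close> and
  \<open>G\<close> with \<open>u\<close> then supplies the families \<open>A\<close> and
  \<open>B\<close>.\<close>

lemma split_curve_exists:
  fixes F G :: "real^'m \<Rightarrow> real^'m"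
  assumes T: "T > 0" and C: "Ck_on 4 UNIV F" "Ck_on 4 UNIV G"
    and u: "\<And>t. t \<in> {0..T} \<Longrightarrow> (u has_vector_derivative (F (u t) + G (u t))) (at t within {0..T})"
  shows "\<exists>A B M. split_curve A B u T M \<and>
    (\<forall>t\<in>{0..T}. A 0 t = F (u t) \<and> A 1 t = time_deriv F G F (u t) \<and>
      B 0 t = G (u t) \<and> B 1 t = time_deriv F G G (u t))"
proof -
  have "k \<le> 4 \<Longrightarrow> smooth_curve k {0..T} u" for k
  proof (induction k)
    case 0
    then show ?case using continuous_on_vector_derivative[OF u] by auto
  next
    case (Suc k)
    then have k: "k \<le> 4" and IH: "smooth_curve k {0..T} u" by auto
    have "smooth_curve k {0..T} (\<lambda>t. F (u t) + G (u t))"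
      by (rule smooth_curve_add[OF Ck_on_mono[OF C(1) k, THEN smooth_curve_compose, OF IH]
            Ck_on_mono[OF C(2) k, THEN smooth_curve_compose, OF IH]])
    then show ?case
      unfolding smooth_curve.simps using u by (intro exI[of _ "\<lambda>t. F (u t) + G (u t)"] conjI ballI)
  qed
  then have su: "smooth_curve 4 {0..T} u" by simp
  have "4 = Suc 3" by simp
  note C' = C[unfolded this]
  obtain A where A: "A 0 = (\<lambda>t. F (u t))"
    "\<And>i t. i < 4 \<Longrightarrow> t \<in> {0..T} \<Longrightarrow> (A i has_vector_derivative A (Suc i) t) (at t within {0..T})"
    "\<And>i. i \<le> 4 \<Longrightarrow> continuous_on {0..T} (A i)"
    by (rule smooth_curve_derivatives[OF smooth_curve_compose[OF C(1) su]]) blast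
  obtain B where B: "B 0 = (\<lambda>t. G (u t))"
    "\<And>i t. i < 4 \<Longrightarrow> t \<in> {0..T} \<Longrightarrow> (B i has_vector_derivative B (Suc i) t) (at t within {0..T})"
    "\<And>i. i \<le> 4 \<Longrightarrow> continuous_on {0..T} (B i)"
    by (rule smooth_curve_derivatives[OF smooth_curve_compose[OF C(2) su]]) blast
  \<comment> \<open>\<open>X 1\<close> is merely some derivative of \<open>X 0\<close>. Uniqueness
    of derivatives on an interval of positive length identifies it with the one from the chain
    rule.\<close>
  have D1: "X 1 t = time_deriv F G H (u t)"
    if H: "Ck_on (Suc 3) UNIV H" and X: "X 0 = (\<lambda>t. H (u t))"
      "(X 0 has_vector_derivative X (Suc 0) t) (at t within {0..T})" and t: "t \<in> {0..T}" for H X t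
  proof -
    have "((\<lambda>t. H (u t)) has_vector_derivative frechet_derivative H (at (u t)) (F (u t) + G (u t)))
        (at t within {0..T})"
      using vector_derivative_diff_chain_within[OF u[OF t] Ck_on_UNIV_derivative[OF H]] by (simp add: o_def)
    then show ?thesis
      using vector_derivative_within_closed_interval[OF T t] X time_deriv_frechet[OF H, of F G "u t"]
      by (metis One_nat_def)
  qed
  obtain P where P: "\<And>i t. i \<in> {..4::nat} \<Longrightarrow> t \<in> {0..T} \<Longrightarrow> norm (A i t) \<le> P"
    by (rule compact_common_bound[of "{0..T}" "{..4::nat}" A]) (use A(3) in auto)
  obtain Q where Q: "\<And>i t. i \<in> {..4::nat} \<Longrightarrow> t \<in> {0..T} \<Longrightarrow> norm (B i t) \<le> Q"
    by (rule compact_common_bound[of "{0..T}" "{..4::nat}" B]) (use B(3) in auto)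
  have "split_curve A B u T (max P Q)"
  proof
    show "norm (A i t) \<le> max P Q" "norm (B i t) \<le> max P Q" if "i \<le> 4" "t \<in> {0..T}" for i t
      using P[of i t] Q[of i t] that by (auto simp: le_max_iff_disj)
    show "(u has_vector_derivative A 0 t + B 0 t) (at t within {0..T})" if "t \<in> {0..T}" for t
      using u[OF that] A(1) B(1) by simp
  qed (use A(2) B(2) in blast)+
  moreover have "A 1 t = time_deriv F G F (u t)" "B 1 t = time_deriv F G G (u t)" if "t \<in> {0..T}" for t
    using D1[of F A t, OF C'(1) A(1) A(2) that] D1[of G B t, OF C'(2) B(1) B(2) that] that by auto
  ultimately show ?thesis using A(1) B(1) 
    by (intro exI[of _ A] exI[of _ B] exI[of _ "max P Q"] conjI ballI) auto
qed

section \<open>Convergence\<close>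

text \<open>Isolates what convergence uses about \<open>u\<close>: it stays in the ball of radius
  \<open>R\<close> and satisfies the scheme up to small defects.\<close>

locale convergent_split = lipschitz_split F G L R
  for F G :: "real^'m \<Rightarrow> real^'m" and L R :: real +
  fixes u :: "real \<Rightarrow> real^'m" and T C :: real
  assumes u_bound: "\<And>t. t \<in> {0..T} \<Longrightarrow> norm (u t) \<le> R"
    and C_nonneg: "0 \<le> C"
    and stage_consistent: "\<And>t h. 0 \<le> t \<Longrightarrow> 0 \<le> h \<Longrightarrow> t + h \<le> T \<Longrightarrow>
      norm (u (t + h / 2) - (u t + (h / 2) *\<^sub>R F (u t) + (h\<^sup>2 / 8) *\<^sub>R F' (u t)
           + (h / 2) *\<^sub>R G (u (t + h / 2)) - (h\<^sup>2 / 8) *\<^sub>R G' (u (t + h / 2)))) \<le> C * h ^ 3"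
    and update_consistent: "\<And>t h. 0 \<le> t \<Longrightarrow> 0 \<le> h \<Longrightarrow> t + h \<le> T \<Longrightarrow>
      norm (u (t + h) - (u t + h *\<^sub>R F (u t) + (h\<^sup>2 / 6) *\<^sub>R (F' (u t) + 2 *\<^sub>R F' (u (t + h / 2)))
           + h *\<^sub>R G (u (t + h)) - (h\<^sup>2 / 6) *\<^sub>R (G' (u (t + h)) + 2 *\<^sub>R G' (u (t + h / 2))))) \<le> C * h ^ 5"
begin

text \<open>Local defects of size \<open>2 * C * (1 + 2 * L) * h ^ 5\<close>, summed over at most
  \<open>T / h\<close> steps and amplified by at most \<open>exp (4 * L * T)\<close>.\<close>

definition "error_const = T * (2 * C * (1 + 2 * L)) * exp (4 * L * T)"

text \<open>The last condition keeps the error bound below 1, which places the iterates in the ball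
  of radius \<open>R + 1\<close> where a step is solvable.\<close>

context
  fixes h :: real
  assumes h: "0 < h" "4 * L * h \<le> 1" "error_const * h ^ 4 \<le> 1"
begin

lemma error_bound_le:
  assumes "real k * h \<le> T"
  shows "real k * h * (2 * C * (1 + 2 * L)) * h ^ 4 * exp (4 * L * (real k * h)) \<le> error_const * h ^ 4"
proof -
  have "real k * h * (2 * C * (1 + 2 * L)) * h ^ 4 * exp (4 * L * (real k * h))
      \<le> T * (2 * C * (1 + 2 * L)) * h ^ 4 * exp (4 * L * T)"
    using assms h C_nonneg L_ge_1
    by (intro mult_mono order_refl mult_nonneg_nonneg) (auto intro: order_trans[of 0 "real k * h"])
  then show ?thesis by (simp add: error_const_def mult_ac)
qed

lemma near_solution:
  assumes "real k * h \<le> T" "norm (v - u (real k * h)) \<le> error_const * h ^ 4"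
  shows "v \<in> cball 0 (R + 1)"
proof -
  have "norm v \<le> norm (u (real k * h)) + norm (v - u (real k * h))" by (rule norm_triangle_sub)
  with u_bound[of "real k * h"] assms h show ?thesis by auto
qed

text \<open>The induction carries the bound \<open>?b k\<close>, which grows with \<open>k\<close>;
  the uniform constant appears only at the end. At each step the bound already proved keeps
  \<open>U k\<close> in the ball, so that stability applies.\<close>

lemma scheme_error:
  assumes "scheme F G h n (u 0) U S" "k \<le> n" "real n * h \<le> T"
  shows "norm (U k - u (real k * h)) \<le> error_const * h ^ 4"
proof -
  let ?D = "2 * C * (1 + 2 * L)"
  let ?b = "\<lambda>k. real k * h * ?D * h ^ 4 * exp (4 * L * (real k * h))"
  have D: "0 \<le> ?D" using C_nonneg L_ge_1 by simp
  have kh: "real k * h \<le> T" if "k \<le> n" for k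
    using order_trans[OF mult_right_mono[of "real k" "real n" h] assms(3)] that h by simp
  have "norm (U k - u (real k * h)) \<le> ?b k"
    using assms(2)
  proof (induction k)
    case 0
    then show ?case using assms(1) by (simp add: scheme_def)
  next
    case (Suc k)
    define t where "t = real k * h"
    have t: "0 \<le> t" "t + h \<le> T" and Suct: "real (Suc k) * h = t + h"
      using kh[of "Suc k"] Suc.prems h by (auto simp: t_def algebra_simps)
    have IH: "norm (U k - u t) \<le> ?b k" using Suc by (simp add: t_def)
    have v: "U k \<in> cball 0 (R + 1)"
      using near_solution[of k "U k"] order_trans[OF IH error_bound_le[of k]] kh[of k] Suc.prems
      by (simp add: t_def)
    have step: "step F G h (U k) (S k) (U (Suc k))"
      using assms(1) Suc.prems by (simp add: scheme_def)
    obtain s w where sw: "s \<in> cball (U k) 1" "w \<in> cball (U k) 1"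
      "\<And>s' w'. step F G h (U k) s' w' \<Longrightarrow> s' = s \<and> w' = w"
      by (rule step_solution[OF v h(1,2)]) blast
    \<comment> \<open>Uniqueness of the step identifies the given stage and next iterate with those
      known to lie within distance 1 of \<open>U k\<close>.\<close>
    have inK: "U k \<in> K" "S k \<in> K" "U (Suc k) \<in> K"
      using sw(1,2) sw(3)[OF step] cball_subset_K[OF v] v by auto
    have u_K: "u r \<in> K" if "r \<in> {0..T}" for r using u_bound[OF that] by simp
    have "norm (U (Suc k) - u (t + h)) \<le> (1 + 4 * L * h) * norm (U k - u t) + ?D * h ^ 5"
      using step_stability[OF inK u_K u_K u_K less_imp_le[OF h(1)] h(2) C_nonneg _ _
          stage_consistent[of t h] update_consistent[of t h]]
        step_equations[OF step h(1)] t h(1) by simp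
    \<comment> \<open>Besides \<open>1 + x \<le> exp x\<close>, the new defect is enlarged by an
      exponential, so that both summands share the factor occurring in
      \<open>?b (Suc k)\<close>.\<close>
    also have "\<dots> \<le> exp (4 * L * h) * ?b k + exp (4 * L * (t + h)) * (?D * h ^ 5)"
    proof (rule add_mono)
      show "(1 + 4 * L * h) * norm (U k - u t) \<le> exp (4 * L * h) * ?b k"
        by (rule mult_mono[OF _ IH]) auto
      have "0 \<le> 4 * L * (t + h)" using t h L_ge_1 by simp
      then have "1 * (?D * h ^ 5) \<le> exp (4 * L * (t + h)) * (?D * h ^ 5)"
        using D h by (intro mult_right_mono) auto
      then show "?D * h ^ 5 \<le> exp (4 * L * (t + h)) * (?D * h ^ 5)" by simp
    qed
    also have "\<dots> = ?b (Suc k)"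
      unfolding Suct t_def[symmetric]
      by (simp add: t_def distrib_left exp_add eval_nat_numeral) (simp add: algebra_simps)
    finally show ?case by (simp only: Suct)
  qed
  with error_bound_le[OF kh] assms(2) show ?thesis by fastforce
qed

lemma scheme_step_solution:
  assumes "scheme F G h n (u 0) U S" "k \<le> n" "real n * h \<le> T"
  obtains s w where "step F G h (U k) s w"
    "\<And>s' w'. step F G h (U k) s' w' \<Longrightarrow> s' = s \<and> w' = w"
proof -
  have "real k * h \<le> T"
    using order_trans[OF mult_right_mono[of "real k" "real n" h] assms(3)] assms(2) h by simp
  from step_solution[OF near_solution[OF this scheme_error[OF assms]] h(1,2)] that show thesis
    by metis
qed

text \<open>The error bound for the \<open>n\<close> steps already constructed guarantees that the
  next one can be solved.\<close>

lemma scheme_exists: "real n * h \<le> T \<Longrightarrow> \<exists>U S. scheme F G h n (u 0) U S"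
proof (induction n)
  case 0
  show ?case by (auto simp: scheme_def)
next
  case (Suc n)
  then have n: "real n * h \<le> T" using h by (simp add: algebra_simps)
  with Suc obtain U S where US: "scheme F G h n (u 0) U S" by blast
  obtain s w where "step F G h (U n) s w"
    using scheme_step_solution[OF US order_refl n] by metis
  with US have "scheme F G h (Suc n) (u 0) (U(Suc n := w)) (S(n := s))"
    by (auto simp: scheme_def less_Suc_eq)
  then show ?case by blast
qed

lemma scheme_unique:
  assumes US: "scheme F G h n (u 0) U S" "scheme F G h n (u 0) U' S'" and n: "real n * h \<le> T"
  shows "(\<forall>k\<le>n. U k = U' k) \<and> (\<forall>k<n. S k = S' k)"
proof -
  have step: "U (Suc k) = U' (Suc k) \<and> S k = S' k" if "k < n" "U k = U' k" for k
  proof -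
    have k: "k \<le> n" using that by simp
    obtain s w where sw: "\<And>s' w'. step F G h (U k) s' w' \<Longrightarrow> s' = s \<and> w' = w"
      by (rule scheme_step_solution[OF US(1) k n]) blast
    have "step F G h (U k) (S k) (U (Suc k))" "step F G h (U k) (S' k) (U' (Suc k))"
      using US that by (auto simp: scheme_def)
    from this[THEN sw] show ?thesis by simp
  qed
  have "k \<le> n \<Longrightarrow> U k = U' k" for k
    by (induction k) (use US step in \<open>auto simp: scheme_def\<close>)
  with step show ?thesis by auto
qed

end

end

theorem theorem3:
  fixes F G :: "real^'m \<Rightarrow> real^'m" and u :: "real \<Rightarrow> real^'m" and T :: real
  assumes "T > 0"
    and "Ck_on 4 UNIV F" and "Ck_on 4 UNIV G" and "Ck_on 5 {0..T} u"
    and "\<forall>t\<in>{0..T}. (u has_vector_derivative (F (u t) + G (u t))) (at t within {0..T})"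
  shows
    "(\<forall>\<^sub>F N in sequentially.
        (\<exists>U S. scheme F G (T / real N) N (u 0) U S) \<and>
        (\<forall>U S U' S'. scheme F G (T / real N) N (u 0) U S \<and> scheme F G (T / real N) N (u 0) U' S' \<longrightarrow>
           (\<forall>n\<le>N. U n = U' n) \<and> (\<forall>n<N. S n = S' n))) \<and>
     (\<forall>U S. (\<forall>\<^sub>F N in sequentially. scheme F G (T / real N) N (u 0) (U N) (S N)) \<longrightarrow>
        (\<lambda>N. norm (U N N - u T)) \<in> O[sequentially](\<lambda>N. (T / real N) ^ 4))"
proof -
  have u: "(u has_vector_derivative (F (u t) + G (u t))) (at t within {0..T})" if "t \<in> {0..T}" for t
    using assms(5) that by blast
  have cont: "continuous_on {0..T} u" using continuous_on_vector_derivative[OF u] .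
  obtain R where R: "\<And>t. t \<in> {0..T} \<Longrightarrow> norm (u t) \<le> R"
    by (rule compact_common_bound[of "{0..T}" "{()}" "\<lambda>_. u"]) (use cont in auto)
  obtain A B M where curve: "split_curve A B u T M"
    "\<forall>t\<in>{0..T}. A 0 t = F (u t) \<and> A 1 t = time_deriv F G F (u t) \<and>
      B 0 t = G (u t) \<and> B 1 t = time_deriv F G G (u t)"
    using split_curve_exists[OF assms(1-3) u] by blast
  interpret split_curve A B u T M by fact
  have M: "0 \<le> M" using M_nonneg[of 0] assms(1) by simp
  have four: "4 = Suc (Suc 2)" by simp
  obtain L where L: "lipschitz_split F G L R"
    by (rule lipschitz_split_exists[OF assms(2,3)[unfolded four]])
  interpret lipschitz_split F G L R by fact
  \<comment> \<open>\<open>4 * M\<close> is the constant of the update defect; the stage constant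
    \<open>M\<close> is enlarged to match it.\<close>
  interpret convergent_split F G L R u T "4 * M"
  proof
    fix t h :: real assume th: "0 \<le> t" "0 \<le> h" "t + h \<le> T"
    then have "M * h ^ 3 \<le> 4 * M * h ^ 3" using M by (simp add: mult_right_mono)
    with stage_defect[of t h] show "norm (u (t + h / 2) - (u t + (h / 2) *\<^sub>R F (u t) + (h\<^sup>2 / 8) *\<^sub>R F' (u t)
           + (h / 2) *\<^sub>R G (u (t + h / 2)) - (h\<^sup>2 / 8) *\<^sub>R G' (u (t + h / 2)))) \<le> 4 * M * h ^ 3"
      using th curve(2) by auto
    show "norm (u (t + h) - (u t + h *\<^sub>R F (u t) + (h\<^sup>2 / 6) *\<^sub>R (F' (u t) + 2 *\<^sub>R F' (u (t + h / 2)))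
           + h *\<^sub>R G (u (t + h)) - (h\<^sup>2 / 6) *\<^sub>R (G' (u (t + h)) + 2 *\<^sub>R G' (u (t + h / 2))))) \<le> 4 * M * h ^ 5"
      using update_defect[of t h] th curve(2) by auto
  qed (use R M in auto)
  have tendsto: "(\<lambda>N. T / real N) \<longlonglongrightarrow> 0" by (rule lim_const_over_n)
  have "(\<lambda>N. 4 * L * (T / real N)) \<longlonglongrightarrow> 4 * L * 0" "(\<lambda>N. error_const * (T / real N) ^ 4) \<longlonglongrightarrow> error_const * 0 ^ 4"
    by (intro tendsto_intros tendsto)+
  then have "\<forall>\<^sub>F N in sequentially. 4 * L * (T / real N) < 1"
    "\<forall>\<^sub>F N in sequentially. error_const * (T / real N) ^ 4 < 1"
    using order_tendstoD(2)[where a = "1::real"] by force+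
  \<comment> \<open>Excluding \<open>N = 0\<close> secures \<open>N * (T / N) = T\<close>, so the
    last iterate is compared with \<open>u T\<close>.\<close>
  then have small: "\<forall>\<^sub>F N in sequentially. 0 < T / real N \<and> 4 * L * (T / real N) \<le> 1 \<and>
      error_const * (T / real N) ^ 4 \<le> 1 \<and> real N * (T / real N) = T"
    using eventually_gt_at_top[of 0] by eventually_elim (use assms(1) in auto)
  show ?thesis
  proof (intro conjI allI impI)
    show "\<forall>\<^sub>F N in sequentially.
        (\<exists>U S. scheme F G (T / real N) N (u 0) U S) \<and>
        (\<forall>U S U' S'. scheme F G (T / real N) N (u 0) U S \<and> scheme F G (T / real N) N (u 0) U' S' \<longrightarrow>
           (\<forall>n\<le>N. U n = U' n) \<and> (\<forall>n<N. S n = S' n))"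
      using small
    proof eventually_elim
      case (elim N)
      then have h: "0 < T / real N" "4 * L * (T / real N) \<le> 1" "error_const * (T / real N) ^ 4 \<le> 1"
        "real N * (T / real N) \<le> T" by linarith+
      show ?case using scheme_exists[OF h] scheme_unique[OF h(1-3) _ _ h(4)] by blast
    qed
    fix U S assume "\<forall>\<^sub>F N in sequentially. scheme F G (T / real N) N (u 0) (U N) (S N)"
    with small have "\<forall>\<^sub>F N in sequentially. norm (norm (U N N - u T)) \<le> error_const * norm ((T / real N) ^ 4)"
    proof eventually_elim
      case (elim N)
      then show ?case using scheme_error[of "T / real N" N "U N" "S N" N] by auto
    qed
    then show "(\<lambda>N. norm (U N N - u T)) \<in> O[sequentially](\<lambda>N. (T / real N) ^ 4)"
      by (rule bigoI)
  qed
qed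

end
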